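(* Let $K$ be a totally disconnected compact group, $\psi:K\to K$ a continuous endomorphism and $U$ an open normal subgroup of $K$ such that $K/(\operatorname{Im}\psi\cdot C(\psi,U))$ is finite. Then $$H_{top}(\psi,U)=\log\left|\frac{\psi^{-1}(C(\psi,U))}{C(\psi,U)}\right|-\log\left|\frac{K}{\operatorname{Im}\psi\cdot C(\psi,U)}\right|.$$
   Context: For an open subgroup $U$ of $K$ and a positive integer $n$, the $n$-th $\psi$-cotrajectory of $U$ is $C_n(\psi,U)=U\cap\psi^{-1}(U)\cap\ldots\cap\psi^{-n+1}(U)$, and the $\psi$-cotrajectory of $U$ is $C(\psi,U)=\bigcap_{n=1}^\infty C_n(\psi,U)=\bigcap_{n=0}^\infty\psi^{-n}(U)$, where $\psi^{-n}(U)=(\psi^n)^{-1}(U)$ is the preimage. The topological entropy of $\psi$ with respect to $U$ is the limit (which exists) $H_{top}(\psi,U)=\lim_{n\to\infty}\frac{\log[K:C_n(\psi,U)]}{n}$. For a subgroup $B$ of a group $A$, $A/B$ denotes the set of cosets and $|A/B|$ the index $[A:B]$ ($B$ is not required to be normal). *)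

theory Defs
  imports "HOL-Analysis.Analysis" "HOL-Algebra.Coset"
begin

locale topological_group = group G for G (structure) +
  fixes T :: "'a topology"
  assumes topspace_eq: "topspace T = carrier G"
    and continuous_mult: "continuous_map (prod_topology T T) T (\<lambda>(x, y). x \<otimes> y)"
    and continuous_inv: "continuous_map T T (\<lambda>x. inv x)"

(* A totally disconnected topological group is automatically Hausdorff: the connected
   component of the identity is closed, so the group is T1 and hence T2. *)
definition totally_disconnected_space :: "'a topology \<Rightarrow> bool" where
  "totally_disconnected_space T \<longleftrightarrow>
     (\<forall>x \<in> topspace T. connected_component_of_set T x = {x})"

definition preimage_on :: "('a, 'b) monoid_scheme \<Rightarrow> ('a \<Rightarrow> 'a) \<Rightarrow> 'a set \<Rightarrow> 'a set" where
  "preimage_on K f S = {x \<in> carrier K. f x \<in> S}"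

(* Only n > 0 is meaningful; for n = 0 the empty intersection is UNIV. *)
definition cotrajectory_n ::
  "('a, 'b) monoid_scheme \<Rightarrow> ('a \<Rightarrow> 'a) \<Rightarrow> 'a set \<Rightarrow> nat \<Rightarrow> 'a set" where
  "cotrajectory_n K \<psi> U n = (\<Inter>i<n. preimage_on K (\<psi> ^^ i) U)"

definition cotrajectory ::
  "('a, 'b) monoid_scheme \<Rightarrow> ('a \<Rightarrow> 'a) \<Rightarrow> 'a set \<Rightarrow> 'a set" where
  "cotrajectory K \<psi> U = (\<Inter>n\<in>{1..}. cotrajectory_n K \<psi> U n)"

(* The index [A : B] for a subgroup B of A, which need not be normal. It is counted with right
   cosets, which are equinumerous with the left ones. If there are infinitely many cosets
   the value is 0 by the convention of card. *)
definition group_index :: "('a, 'b) monoid_scheme \<Rightarrow> 'a set \<Rightarrow> nat" where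
  "group_index A B = card (rcosets\<^bsub>A\<^esub> B)"

definition H_top :: "('a, 'b) monoid_scheme \<Rightarrow> ('a \<Rightarrow> 'a) \<Rightarrow> 'a set \<Rightarrow> real" where
  "H_top K \<psi> U = lim (\<lambda>n. ln (real (group_index K (cotrajectory_n K \<psi> U n))) / real n)"

end

theory Submission
  imports Defs "HOL-Algebra.Zassenhaus"
begin

text \<open>
  Write \<open>C n\<close> for the \<open>n\<close>-th cotrajectory and \<open>C\<close> for their intersection. All \<open>C n\<close> with
  \<open>n \<ge> 1\<close> are normal subgroups of finite index, and \<open>C (n + 1) = U \<inter> \<psi>\<^sup>-\<^sup>1(C n)\<close>. Counting cosets
  along \<open>C (n + 1) \<subseteq> \<psi>\<^sup>-\<^sup>1(C n) \<subseteq> K\<close> and \<open>C n \<subseteq> Im \<psi> \<cdot> C n \<subseteq> K\<close>, and using that \<open>\<psi>\<close> identifies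
  the cosets of \<open>\<psi>\<^sup>-\<^sup>1(C n)\<close> in \<open>K\<close> with those of \<open>C n\<close> in \<open>Im \<psi> \<cdot> C n\<close>, one finds
  \<open>[K : C (n + 1)] \<cdot> [K : Im \<psi> \<cdot> C n] = [K : C n] \<cdot> [\<psi>\<^sup>-\<^sup>1(C n) : C (n + 1)]\<close>
  (lemma \<open>index_recursion\<close>).

  Both correction factors become constant. The index \<open>[\<psi>\<^sup>-\<^sup>1(C n) : U \<inter> \<psi>\<^sup>-\<^sup>1(C n)]\<close> counts the
  cosets of \<open>U\<close> that meet \<open>\<psi>\<^sup>-\<^sup>1(C n)\<close>. There are finitely many cosets of \<open>U\<close>, and by compactness
  one that meets every \<open>\<psi>\<^sup>-\<^sup>1(C n)\<close> meets \<open>\<psi>\<^sup>-\<^sup>1(C)\<close>, so the index is eventually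
  \<open>[\<psi>\<^sup>-\<^sup>1(C) : C]\<close>. Likewise the groups \<open>Im \<psi> \<cdot> C n\<close> decrease and, by compactness, intersect
  in \<open>Im \<psi> \<cdot> C\<close>; that group has finite index, so they are eventually equal to it.

  Hence \<open>[K : C (n + 1)] / [K : C n]\<close> is eventually the constant
  \<open>[\<psi>\<^sup>-\<^sup>1(C) : C] / [K : Im \<psi> \<cdot> C]\<close>, and the logarithm of this constant is the growth rate.
\<close>

section \<open>Counting cosets\<close>

lemma group_index_carrier_update:
  "group_index (G\<lparr>carrier := A\<rparr>) B = card (r_coset G B ` A)"
  unfolding group_index_def RCOSETS_def r_coset_def
  by (simp add: UNION_singleton_eq_range)

lemma RCOSETS_eq_image: "rcosets\<^bsub>G\<^esub> B = r_coset G B ` carrier G"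
  by (auto simp: RCOSETS_def)

lemma group_index_eq: "group_index G B = card (r_coset G B ` carrier G)"
  by (simp add: group_index_def RCOSETS_eq_image)

lemma card_image_cong_kernel:
  assumes "\<And>x y. x \<in> A \<Longrightarrow> y \<in> A \<Longrightarrow> f x = f y \<longleftrightarrow> g x = g y"
  shows "card (f ` A) = card (g ` A)" and "finite (f ` A) \<longleftrightarrow> finite (g ` A)"
proof -
  \<comment> \<open>The map \<open>f x \<mapsto> g x\<close>; the choice of \<open>x\<close> does not matter since \<open>f\<close> and \<open>g\<close> have the same fibres.\<close>
  define h where "h = (\<lambda>z. g (inv_into A f z))"
  have h: "h (f x) = g x" if "x \<in> A" for x
    using assms[of "inv_into A f (f x)" x] that
    by (simp add: h_def inv_into_into f_inv_into_f)
  have "bij_betw h (f ` A) (g ` A)"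
    by (rule bij_betw_imageI) (auto simp: inj_on_def h assms image_image)
  then show "card (f ` A) = card (g ` A)" "finite (f ` A) \<longleftrightarrow> finite (g ` A)"
    by (auto dest: bij_betw_same_card bij_betw_finite)
qed

context group
begin

lemma rcoset_eq_iff:
  assumes "subgroup B G" "x \<in> carrier G" "y \<in> carrier G"
  shows "B #> x = B #> y \<longleftrightarrow> x \<otimes> inv y \<in> B"
proof
  assume "B #> x = B #> y"
  then have "x \<in> B #> y"
    using rcos_self[OF assms(2,1)] by simp
  then obtain b where "b \<in> B" "x = b \<otimes> y"
    by (auto simp: r_coset_def)
  then show "x \<otimes> inv y \<in> B"
    using assms subgroup.mem_carrier[OF assms(1)] by (simp add: m_assoc)
next
  assume *: "x \<otimes> inv y \<in> B"
  have "x = (x \<otimes> inv y) \<otimes> y"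
    using assms by (simp add: m_assoc)
  then have "x \<in> B #> y"
    using * unfolding r_coset_def by blast
  then show "B #> x = B #> y"
    using repr_independence[OF _ assms(3,1)] by simp
qed

lemma rcoset_eq_self_iff:
  assumes "subgroup B G" "x \<in> carrier G"
  shows "B #> x = B \<longleftrightarrow> x \<in> B"
  using rcoset_eq_iff[OF assms one_closed] assms
  by (simp add: subgroup.subset)

text \<open>A coset of a subgroup determines the coset of any larger subgroup.\<close>

lemma finite_rcosets_larger:
  assumes "subgroup B G" "subgroup B' G" "B \<subseteq> B'" "A \<subseteq> carrier G"
    and "finite (r_coset G B ` A)"
  shows "finite (r_coset G B' ` A)"
proof -
  have "B' #> a = B' <#> (B #> a)" if "a \<in> A" for a
  proof -
    have "B' <#> (B #> a) = (B' <#> B) #> a"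
      using assms that by (intro setmult_rcos_assoc) (auto simp: subgroup.subset)
    also have "B' <#> B = B'"
    proof
      show "B' <#> B \<subseteq> B'"
        using assms(3) subgroup.m_closed[OF assms(2)] by (auto simp: set_mult_def)
      show "B' \<subseteq> B' <#> B"
      proof
        fix b assume b: "b \<in> B'"
        then have "b = b \<otimes> \<one>" using subgroup.mem_carrier[OF assms(2)] by simp
        then show "b \<in> B' <#> B"
          using b subgroup.one_closed[OF assms(1)] unfolding set_mult_def by blast
      qed
    qed
    finally show ?thesis ..
  qed
  then have "r_coset G B' ` A = (\<lambda>X. B' <#> X) ` (r_coset G B ` A)"
    by (auto simp: image_image)
  then show ?thesis
    using assms(5) by simp
qed

text \<open>
  The cosets of \<open>C\<close> inside one coset \<open>B #> a\<close> are the right translates by \<open>a\<close> of the cosets of \<open>C\<close>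
  inside \<open>B\<close>, so each fibre of the map from cosets of \<open>C\<close> to cosets of \<open>B\<close> has the same size.
\<close>

lemma index_tower:
  assumes C: "subgroup C G" and B: "subgroup B G" and A: "subgroup A G"
    and "C \<subseteq> B" "B \<subseteq> A"
    and fin: "finite (r_coset G B ` A)" "finite (r_coset G C ` B)"
  shows "finite (r_coset G C ` A)"
    and "card (r_coset G C ` A) = card (r_coset G B ` A) * card (r_coset G C ` B)"
proof -
  note sub = subgroup.mem_carrier[OF A] subgroup.mem_carrier[OF B] subgroup.mem_carrier[OF C]
  define F where "F D = r_coset G C ` D" for D
  have fibre: "finite (F D) \<and> card (F D) = card (r_coset G C ` B)"
    if D: "D \<in> r_coset G B ` A" for D
  proof -
    obtain a where a: "a \<in> A" "D = B #> a" using D by auto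
    have ac: "a \<in> carrier G" using a sub by simp
    have "F D = (\<lambda>b. C #> (b \<otimes> a)) ` B"
      unfolding F_def a(2) r_coset_def[of G B a] by auto
    moreover have "C #> (x \<otimes> a) = C #> (y \<otimes> a) \<longleftrightarrow> C #> x = C #> y"
      if "x \<in> B" "y \<in> B" for x y
    proof -
      have "(x \<otimes> a) \<otimes> inv (y \<otimes> a) = x \<otimes> inv y"
        using that sub ac by (simp add: inv_mult_group m_assoc inv_solve_left)
          (simp add: m_assoc[symmetric])
      then show ?thesis
        using rcoset_eq_iff[OF C] that sub ac by simp
    qed
    ultimately show ?thesis
      using card_image_cong_kernel[of B "\<lambda>b. C #> (b \<otimes> a)" "r_coset G C"] fin(2) by simp
  qed
  have disj: "F D \<inter> F E = {}" if DE: "D \<in> r_coset G B ` A" "E \<in> r_coset G B ` A" "D \<noteq> E" for D E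
  proof (rule ccontr)
    assume "F D \<inter> F E \<noteq> {}"
    then obtain x y where xy: "x \<in> D" "y \<in> E" "C #> x = C #> y"
      unfolding F_def by auto
    obtain a b where ab: "a \<in> A" "D = B #> a" "b \<in> A" "E = B #> b"
      using DE(1,2) by blast
    then have c: "x \<in> carrier G" "y \<in> carrier G"
      using xy sub r_coset_subset_G[OF subgroup.subset[OF B]] by blast+
    then have "B #> x = B #> y"
      using xy(3) \<open>C \<subseteq> B\<close> rcoset_eq_iff[OF B] rcoset_eq_iff[OF C] by blast
    moreover have "D = B #> x" "E = B #> y"
      using xy ab repr_independence[OF _ _ B] sub by simp_all
    ultimately show False using DE(3) by simp
  qed
  have "\<Union> (r_coset G B ` A) = A"
  proof
    show "\<Union> (r_coset G B ` A) \<subseteq> A"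
      using \<open>B \<subseteq> A\<close> subgroup.m_closed[OF A] by (auto simp: r_coset_def)
    show "A \<subseteq> \<Union> (r_coset G B ` A)"
      using rcos_self[OF _ B] sub by blast
  qed
  then have union: "r_coset G C ` A = \<Union> (F ` (r_coset G B ` A))"
    unfolding F_def by (metis image_Union)
  show "finite (r_coset G C ` A)"
    unfolding union using fin(1) fibre by blast
  have "card (\<Union> (F ` (r_coset G B ` A))) = (\<Sum>D\<in>r_coset G B ` A. card (F D))"
    using fin(1) fibre disj by (intro card_UN_disjoint) auto
  then show "card (r_coset G C ` A) = card (r_coset G B ` A) * card (r_coset G C ` B)"
    unfolding union using fibre by simp
qed

text \<open>
  For \<open>x, y \<in> A\<close> the quotient \<open>x \<otimes> inv y\<close> lies in \<open>A\<close> anyway, so congruence modulo \<open>U \<inter> A\<close> is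
  congruence modulo \<open>U\<close>. This turns \<open>[A : U \<inter> A]\<close> into a number of cosets of the fixed group \<open>U\<close>,
  which can be compared for varying \<open>A\<close>.
\<close>

lemma rcosets_Int:
  assumes "subgroup A G" "subgroup U G"
  shows "card (r_coset G (U \<inter> A) ` A) = card (r_coset G U ` A)"
    and "finite (r_coset G (U \<inter> A) ` A) \<longleftrightarrow> finite (r_coset G U ` A)"
proof -
  have "(U \<inter> A) #> x = (U \<inter> A) #> y \<longleftrightarrow> U #> x = U #> y" if "x \<in> A" "y \<in> A" for x y
    using that rcoset_eq_iff[OF assms(2)] rcoset_eq_iff[OF subgroups_Inter_pair[OF assms(2,1)]]
      subgroup.mem_carrier[OF assms(1)] subgroup.m_closed[OF assms(1)]
      subgroup.m_inv_closed[OF assms(1)]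
    by auto
  then show "card (r_coset G (U \<inter> A) ` A) = card (r_coset G U ` A)"
    "finite (r_coset G (U \<inter> A) ` A) \<longleftrightarrow> finite (r_coset G U ` A)"
    by (rule card_image_cong_kernel; blast)+
qed

end

section \<open>Preimages and images under an endomorphism\<close>

locale group_endomorphism = group G for G (structure) +
  fixes \<psi> :: "'a \<Rightarrow> 'a"
  assumes endo: "\<psi> \<in> hom G G"
begin

lemma group_hom_endo: "group_hom G G \<psi>"
  using endo by (unfold_locales) auto

lemma endo_closed: "x \<in> carrier G \<Longrightarrow> \<psi> x \<in> carrier G"
  using group_hom.hom_closed[OF group_hom_endo] .

lemma preimage_normal:
  assumes "H \<lhd> G"
  shows "preimage_on G \<psi> H \<lhd> G"
proof -
  interpret h: group_hom G G \<psi> by (rule group_hom_endo)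
  interpret H: normal H G by fact
  show ?thesis
    unfolding normal_inv_iff
    by (auto simp: preimage_on_def H.inv_op_closed2 intro!: subgroupI)
qed

lemma subgroup_image_carrier: "subgroup (\<psi> ` carrier G) G"
  using group_hom.img_is_subgroup[OF group_hom_endo] .

lemma subgroup_image_mult:
  assumes "H \<lhd> G"
  shows "subgroup ((\<psi> ` carrier G) <#> H) G"
  unfolding commut_normal[OF subgroup_image_carrier assms]
  using mult_norm_subgroup[OF assms subgroup_image_carrier] .

lemma subset_image_mult:
  assumes "H \<lhd> G"
  shows "H \<subseteq> (\<psi> ` carrier G) <#> H"
proof
  fix h assume "h \<in> H"
  moreover have "\<one> \<in> \<psi> ` carrier G"
    using subgroup.one_closed[OF subgroup_image_carrier] .
  moreover have "h = \<one> \<otimes> h"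
    using \<open>h \<in> H\<close> assms normal_imp_subgroup subgroup.mem_carrier by fastforce
  ultimately show "h \<in> (\<psi> ` carrier G) <#> H"
    unfolding set_mult_def by blast
qed

text \<open>
  Since \<open>H\<close> is normal, every coset of \<open>H\<close> in \<open>Im \<psi> \<cdot> H\<close> is represented by an element of \<open>Im \<psi>\<close>,
  and \<open>\<psi> x\<close>, \<open>\<psi> y\<close> represent the same one iff \<open>x\<close>, \<open>y\<close> agree modulo the preimage of \<open>H\<close>.
\<close>

lemma rcosets_preimage:
  assumes "H \<lhd> G"
  shows "card (r_coset G (preimage_on G \<psi> H) ` carrier G)
           = card (r_coset G H ` ((\<psi> ` carrier G) <#> H))"
    and "finite (r_coset G (preimage_on G \<psi> H) ` carrier G)
           \<longleftrightarrow> finite (r_coset G H ` ((\<psi> ` carrier G) <#> H))"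
proof -
  interpret h: group_hom G G \<psi> by (rule group_hom_endo)
  have H: "subgroup H G" using assms by (rule normal_imp_subgroup)
  have P: "subgroup (preimage_on G \<psi> H) G"
    using preimage_normal[OF assms] by (rule normal_imp_subgroup)
  have "(\<psi> ` carrier G) <#> H = H <#> (\<psi> ` carrier G)"
    by (rule commut_normal[OF subgroup_image_carrier assms])
  then have "r_coset G H ` ((\<psi> ` carrier G) <#> H)
      = (\<Union>h\<in>H. (\<lambda>x. H #> (h \<otimes> \<psi> x)) ` carrier G)"
    by (auto simp: set_mult_def)
  also have "\<dots> = (\<Union>h\<in>H. (\<lambda>x. H #> \<psi> x) ` carrier G)"
  proof -
    have "H #> (h \<otimes> \<psi> x) = H #> \<psi> x" if "h \<in> H" "x \<in> carrier G" for h x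
      using that H by (simp add: rcoset_eq_iff subgroup.mem_carrier[OF H] m_assoc)
    then show ?thesis by simp
  qed
  also have "\<dots> = (\<lambda>x. H #> \<psi> x) ` carrier G"
    using subgroup.one_closed[OF H] by auto
  finally have eq: "r_coset G H ` ((\<psi> ` carrier G) <#> H) = (\<lambda>x. H #> \<psi> x) ` carrier G" .
  have "preimage_on G \<psi> H #> x = preimage_on G \<psi> H #> y \<longleftrightarrow> H #> \<psi> x = H #> \<psi> y"
    if "x \<in> carrier G" "y \<in> carrier G" for x y
    using that by (simp add: rcoset_eq_iff[OF P] rcoset_eq_iff[OF H]) (simp add: preimage_on_def)
  then show "card (r_coset G (preimage_on G \<psi> H) ` carrier G)
           = card (r_coset G H ` ((\<psi> ` carrier G) <#> H))"
    "finite (r_coset G (preimage_on G \<psi> H) ` carrier G)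
           \<longleftrightarrow> finite (r_coset G H ` ((\<psi> ` carrier G) <#> H))"
    unfolding eq by (rule card_image_cong_kernel; blast)+
qed

text \<open>
  The tower \<open>U \<inter> \<psi>\<^sup>-\<^sup>1(H) \<subseteq> \<psi>\<^sup>-\<^sup>1(H) \<subseteq> G\<close> expresses the index of the first group through that of the
  second, which the tower \<open>H \<subseteq> Im \<psi> \<cdot> H \<subseteq> G\<close> expresses through the index of \<open>H\<close>.
\<close>

lemma index_recursion:
  assumes "U \<lhd> G" "H \<lhd> G"
    and finU: "finite (r_coset G U ` carrier G)" and finH: "finite (r_coset G H ` carrier G)"
  shows "finite (r_coset G (U \<inter> preimage_on G \<psi> H) ` carrier G)"
    and "card (r_coset G (U \<inter> preimage_on G \<psi> H) ` carrier G)
           * card (r_coset G ((\<psi> ` carrier G) <#> H) ` carrier G)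
         = card (r_coset G H ` carrier G) * card (r_coset G U ` preimage_on G \<psi> H)"
proof -
  let ?P = "preimage_on G \<psi> H" and ?M = "(\<psi> ` carrier G) <#> H"
  have U: "subgroup U G" and H: "subgroup H G" and P: "subgroup ?P G" and M: "subgroup ?M G"
    using assms preimage_normal subgroup_image_mult by (auto intro: normal_imp_subgroup)
  have HM: "H \<subseteq> ?M" using subset_image_mult[OF assms(2)] .
  have MG: "?M \<subseteq> carrier G" and PG: "?P \<subseteq> carrier G"
    using M P by (auto simp: subgroup.mem_carrier)
  have finM: "finite (r_coset G ?M ` carrier G)"
    using finite_rcosets_larger[OF H M HM subset_refl finH] .
  have finHM: "finite (r_coset G H ` ?M)"
    using finH MG by (meson finite_subset image_mono)
  have finP: "finite (r_coset G ?P ` carrier G)"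
    using finHM rcosets_preimage(2)[OF assms(2)] by simp
  have finUP: "finite (r_coset G (U \<inter> ?P) ` ?P)"
    using rcosets_Int(2)[OF P U] finU PG by (meson finite_subset image_mono)
  note tower1 = index_tower[OF subgroups_Inter_pair[OF U P] P subgroup_self Int_lower2 PG finP finUP]
  show "finite (r_coset G (U \<inter> ?P) ` carrier G)" by (rule tower1(1))
  show "card (r_coset G (U \<inter> ?P) ` carrier G) * card (r_coset G ?M ` carrier G)
         = card (r_coset G H ` carrier G) * card (r_coset G U ` ?P)"
    using tower1(2) index_tower(2)[OF H M subgroup_self HM MG finM finHM]
      rcosets_preimage(1)[OF assms(2)] rcosets_Int(1)[OF P U]
    by (simp add: mult.commute mult.left_commute)
qed

lemma cotrajectory_n_1:
  assumes "U \<subseteq> carrier G"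
  shows "cotrajectory_n G \<psi> U (Suc 0) = U"
  using assms by (auto simp: cotrajectory_n_def preimage_on_def)

lemma mem_cotrajectory_n_Suc:
  "x \<in> cotrajectory_n G \<psi> U (Suc n) \<longleftrightarrow> x \<in> carrier G \<and> (\<forall>i\<le>n. (\<psi> ^^ i) x \<in> U)"
  by (auto simp: cotrajectory_n_def preimage_on_def less_Suc_eq_le)

lemma cotrajectory_eq: "cotrajectory G \<psi> U = (\<Inter>n. cotrajectory_n G \<psi> U (Suc n))"
proof -
  have "{1..} = range Suc" by (auto simp: image_iff) presburger
  then show ?thesis unfolding cotrajectory_def by simp
qed

lemma mem_cotrajectory:
  "x \<in> cotrajectory G \<psi> U \<longleftrightarrow> x \<in> carrier G \<and> (\<forall>i. (\<psi> ^^ i) x \<in> U)"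
  unfolding cotrajectory_eq by (auto simp: mem_cotrajectory_n_Suc)

lemma cotrajectory_n_Suc_Suc:
  assumes "U \<subseteq> carrier G"
  shows "cotrajectory_n G \<psi> U (Suc (Suc n)) = U \<inter> preimage_on G \<psi> (cotrajectory_n G \<psi> U (Suc n))"
    (is "?L = ?R")
proof (rule Set.set_eqI)
  fix x
  have "(\<forall>i\<le>Suc n. (\<psi> ^^ i) x \<in> U) \<longleftrightarrow> x \<in> U \<and> (\<forall>i\<le>n. (\<psi> ^^ i) (\<psi> x) \<in> U)"
    using All_less_Suc2[of "Suc n" "\<lambda>i. (\<psi> ^^ i) x \<in> U"]
    by (simp add: less_Suc_eq_le funpow_Suc_right del: funpow.simps(2))
  then show "x \<in> ?L \<longleftrightarrow> x \<in> ?R"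
    using assms endo_closed
    by (auto simp: mem_cotrajectory_n_Suc preimage_on_def)
qed

lemma cotrajectory_invariance:
  assumes "U \<subseteq> carrier G"
  shows "cotrajectory G \<psi> U = U \<inter> preimage_on G \<psi> (cotrajectory G \<psi> U)"
    (is "?L = ?R")
proof (rule Set.set_eqI)
  fix x
  have "(\<forall>i. (\<psi> ^^ i) x \<in> U) \<longleftrightarrow> (\<psi> ^^ 0) x \<in> U \<and> (\<forall>i. (\<psi> ^^ Suc i) x \<in> U)"
    by (metis nat.exhaust)
  then have "(\<forall>i. (\<psi> ^^ i) x \<in> U) \<longleftrightarrow> x \<in> U \<and> (\<forall>i. (\<psi> ^^ i) (\<psi> x) \<in> U)"
    by (simp add: funpow_Suc_right del: funpow.simps(2))
  then show "x \<in> ?L \<longleftrightarrow> x \<in> ?R"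
    using assms endo_closed
    by (auto simp: mem_cotrajectory preimage_on_def)
qed

lemma cotrajectory_n_normal:
  assumes "U \<lhd> G"
  shows "cotrajectory_n G \<psi> U (Suc n) \<lhd> G"
proof (induction n)
  case 0
  then show ?case
    using assms cotrajectory_n_1 normal_imp_subgroup subgroup.subset by metis
next
  case (Suc n)
  then show ?case
    using assms normal_subgroup_intersect preimage_normal[OF Suc] cotrajectory_n_Suc_Suc
      normal_imp_subgroup subgroup.subset by metis
qed

lemma cotrajectory_normal:
  assumes "U \<lhd> G"
  shows "cotrajectory G \<psi> U \<lhd> G"
  using cotrajectory_n_normal[OF assms] unfolding cotrajectory_eq normal_inv_iff
  by (auto intro!: subgroups_Inter)

lemma decseq_cotrajectory_n: "decseq (\<lambda>n. cotrajectory_n G \<psi> U (Suc n))"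
  by (rule decseq_SucI) (auto simp: mem_cotrajectory_n_Suc)

end

section \<open>Compactness\<close>

text \<open>
  Each member of the finite set that is missing from the limit image drops out at some stage,
  and there are only finitely many of them.
\<close>

lemma decseq_image_stabilizes:
  fixes A :: "nat \<Rightarrow> 'a set"
  assumes "decseq A" "\<And>n. L \<subseteq> A n" "finite (f ` A 0)"
    and lim: "\<And>z. (\<And>n. z \<in> f ` A n) \<Longrightarrow> z \<in> f ` L"
  shows "eventually (\<lambda>n. f ` A n = f ` L) sequentially"
proof -
  have "eventually (\<lambda>n. z \<in> f ` A n \<longrightarrow> z \<in> f ` L) sequentially" for z
  proof (cases "z \<in> f ` L")
    case False
    then obtain m where "z \<notin> f ` A m" using lim by blast
    then have "z \<notin> f ` A n" if "n \<ge> m" for n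
      using decseqD[OF assms(1) that] by blast
    then show ?thesis unfolding eventually_sequentially by blast
  qed simp
  then have "eventually (\<lambda>n. \<forall>z\<in>f ` A 0. z \<in> f ` A n \<longrightarrow> z \<in> f ` L) sequentially"
    using assms(3) by (intro eventually_ball_finite) auto
  then show ?thesis
  proof eventually_elim
    case (elim n)
    have "f ` A n \<subseteq> f ` A 0" using decseqD[OF assms(1), of 0 n] by blast
    with elim assms(2)[of n] show ?case by blast
  qed
qed

context topological_group
begin

lemma continuous_map_mult:
  assumes "continuous_map T T f" "continuous_map T T g"
  shows "continuous_map T T (\<lambda>x. f x \<otimes> g x)"
proof -
  have "continuous_map T (prod_topology T T) (\<lambda>x. (f x, g x))"
    using assms by (simp add: continuous_map_pairedI)
  from continuous_map_compose[OF this continuous_mult] show ?thesis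
    by (simp add: comp_def)
qed

lemma continuous_map_const_carrier: "a \<in> carrier G \<Longrightarrow> continuous_map T T (\<lambda>x. a)"
  by (simp add: topspace_eq)

lemma rcoset_eq_preimage:
  assumes "subgroup U G" "a \<in> carrier G"
  shows "U #> a = {x \<in> topspace T. x \<otimes> inv a \<in> U}"
proof -
  have "x \<in> U #> a \<longleftrightarrow> x \<in> carrier G \<and> x \<otimes> inv a \<in> U" for x
    using rcoset_eq_iff[OF assms(1) _ assms(2)] repr_independence[OF _ assms(2,1)]
      rcos_self[OF _ assms(1)] r_coset_subset_G[OF subgroup.subset[OF assms(1)] assms(2)]
    by blast
  then show ?thesis by (auto simp: topspace_eq)
qed

lemma openin_rcoset:
  assumes "subgroup U G" "openin T U" "a \<in> carrier G"
  shows "openin T (U #> a)"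
  unfolding rcoset_eq_preimage[OF assms(1,3)]
  using assms by (intro openin_continuous_map_preimage[OF continuous_map_mult]
      continuous_map_const_carrier) auto

lemma closedin_rcoset:
  assumes "subgroup U G" "closedin T U" "a \<in> carrier G"
  shows "closedin T (U #> a)"
  unfolding rcoset_eq_preimage[OF assms(1,3)]
  using assms by (intro closedin_continuous_map_preimage[OF continuous_map_mult]
      continuous_map_const_carrier) auto

text \<open>The complement of an open subgroup is a union of its cosets, which are open.\<close>

lemma open_subgroup_closed:
  assumes U: "subgroup U G" and "openin T U"
  shows "closedin T U"
proof -
  have "topspace T - U = \<Union> (r_coset G U ` (carrier G - U))"
  proof
    show "topspace T - U \<subseteq> \<Union> (r_coset G U ` (carrier G - U))"
      using rcos_self[OF _ U] by (auto simp: topspace_eq)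
    show "\<Union> (r_coset G U ` (carrier G - U)) \<subseteq> topspace T - U"
    proof clarify
      fix a x assume a: "a \<in> carrier G" "a \<notin> U" and x: "x \<in> U #> a"
      have "x \<in> carrier G"
        using x a r_coset_subset_G[OF subgroup.subset[OF U]] by blast
      moreover have "x \<notin> U"
        using repr_independence[OF x a(1) U] rcoset_eq_self_iff[OF U] a \<open>x \<in> carrier G\<close> by metis
      ultimately show "x \<in> topspace T - U" by (simp add: topspace_eq)
    qed
  qed
  moreover have "openin T (\<Union> (r_coset G U ` (carrier G - U)))"
    using openin_rcoset[OF assms] by blast
  ultimately show ?thesis
    using subgroup.subset[OF U] by (simp add: closedin_def topspace_eq)
qed

text \<open>
  The cosets cover the group by pairwise disjoint nonempty open sets, and a subcover of such a
  cover must contain all of it.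
\<close>

lemma finite_rcosets_open:
  assumes "compact_space T" and U: "subgroup U G" and "openin T U"
  shows "finite (r_coset G U ` carrier G)"
proof -
  have cover: "topspace T \<subseteq> \<Union> (r_coset G U ` carrier G)"
    using rcos_self[OF _ U] by (auto simp: topspace_eq)
  then obtain F where F: "finite F" "F \<subseteq> r_coset G U ` carrier G" "topspace T \<subseteq> \<Union> F"
    using assms(1) openin_rcoset[OF U assms(3)]
    unfolding compact_space_alt by (metis (no_types, lifting) image_iff)
  have "r_coset G U ` carrier G \<subseteq> F"
  proof clarify
    fix a assume a: "a \<in> carrier G"
    then obtain D where D: "D \<in> F" "a \<in> D" using F(3) by (auto simp: topspace_eq)
    then obtain b where "b \<in> carrier G" "D = U #> b" using F(2) by blast
    then show "U #> a \<in> F" using D repr_independence[OF _ _ U] by simp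
  qed
  then show ?thesis using F(1) finite_subset by blast
qed

end

section \<open>The cotrajectory of an open normal subgroup\<close>

locale compact_group_endomorphism = topological_group G T + group_endomorphism G \<psi>
  for G (structure) and T :: "'a topology" and \<psi> :: "'a \<Rightarrow> 'a" +
  fixes U :: "'a set"
  assumes compact: "compact_space T"
    and cont: "continuous_map T T \<psi>"
    and normal: "U \<lhd> G"
    and open_U: "openin T U"
begin

text \<open>
  The index is shifted because the cotrajectory for \<open>n = 0\<close> is an empty intersection, that is
  \<open>UNIV\<close>, and not a subgroup; \<open>C_n 0\<close> is \<open>U\<close>.
\<close>

abbreviation C_n :: "nat \<Rightarrow> 'a set" where "C_n n \<equiv> cotrajectory_n G \<psi> U (Suc n)"
abbreviation C_lim :: "'a set" where "C_lim \<equiv> cotrajectory G \<psi> U"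

lemma subgroup_U: "subgroup U G"
  using normal by (rule normal_imp_subgroup)

lemma U_subset: "U \<subseteq> carrier G"
  using subgroup_U by (rule subgroup.subset)

lemma closedin_preimage_on:
  assumes "closedin T S"
  shows "closedin T (preimage_on G \<psi> S)"
  using closedin_continuous_map_preimage[OF cont assms]
  by (simp add: preimage_on_def topspace_eq)

lemma closedin_C_n: "closedin T (C_n n)"
proof (induction n)
  case 0
  then show ?case
    using open_subgroup_closed[OF subgroup_U open_U] cotrajectory_n_1[OF U_subset] by simp
next
  case (Suc n)
  then show ?case
    using open_subgroup_closed[OF subgroup_U open_U] closedin_preimage_on
    by (simp add: cotrajectory_n_Suc_Suc[OF U_subset] closedin_Int)
qed

lemma finite_rcosets_U: "finite (r_coset G U ` carrier G)"
  using finite_rcosets_open[OF compact subgroup_U open_U] .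

lemma finite_rcosets_C_n: "finite (r_coset G (C_n n) ` carrier G)"
proof (induction n)
  case 0
  then show ?case using finite_rcosets_U cotrajectory_n_1[OF U_subset] by simp
next
  case (Suc n)
  then show ?case
    using index_recursion(1)[OF normal cotrajectory_n_normal[OF normal] finite_rcosets_U]
    by (simp add: cotrajectory_n_Suc_Suc[OF U_subset])
qed

text \<open>
  If a coset of \<open>U\<close> meets all the closed sets \<open>\<psi>\<^sup>-\<^sup>1(C_n n)\<close>, then, being closed itself, it meets
  their intersection \<open>\<psi>\<^sup>-\<^sup>1(C_lim)\<close>. The finitely many cosets of \<open>U\<close> thus settle at a finite stage.
\<close>

lemma rcosets_preimage_stabilize:
  "eventually (\<lambda>n. r_coset G U ` preimage_on G \<psi> (C_n n) = r_coset G U ` preimage_on G \<psi> C_lim)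
     sequentially"
proof (rule decseq_image_stabilizes)
  show dec: "decseq (\<lambda>n. preimage_on G \<psi> (C_n n))"
    using decseq_cotrajectory_n[of U] unfolding decseq_def preimage_on_def by blast
  show "preimage_on G \<psi> C_lim \<subseteq> preimage_on G \<psi> (C_n n)" for n
    unfolding cotrajectory_eq by (auto simp: preimage_on_def)
  show "finite (r_coset G U ` preimage_on G \<psi> (C_n 0))"
    by (rule finite_subset[OF _ finite_rcosets_U]) (auto simp: preimage_on_def)
  fix D assume D: "\<And>n. D \<in> r_coset G U ` preimage_on G \<psi> (C_n n)"
  then obtain a where a: "a \<in> carrier G" "D = U #> a"
    by (force simp: preimage_on_def)
  define S where "S n = preimage_on G \<psi> (C_n n) \<inter> D" for n
  have "(\<Inter>n. S n) \<noteq> {}"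
  proof (rule compact_space_imp_nest[OF compact])
    show "closedin T (S n)" for n
      unfolding S_def a(2)
      using closedin_preimage_on[OF closedin_C_n] a(1) subgroup_U
        closedin_rcoset[OF _ open_subgroup_closed] open_U by blast
    show "S n \<noteq> {}" for n
    proof -
      obtain x where "x \<in> preimage_on G \<psi> (C_n n)" "D = U #> x" using D by blast
      then show ?thesis
        unfolding S_def using rcos_self[OF _ subgroup_U] by (auto simp: preimage_on_def)
    qed
    show "decseq S"
      using dec unfolding decseq_def S_def by blast
  qed
  then obtain x where x: "\<And>n. x \<in> S n" by blast
  then have "x \<in> preimage_on G \<psi> C_lim"
    unfolding cotrajectory_eq S_def by (auto simp: preimage_on_def)
  moreover have "D = U #> x"
    using x[of 0] a repr_independence[OF _ a(1) subgroup_U] by (simp add: S_def)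
  ultimately show "D \<in> r_coset G U ` preimage_on G \<psi> C_lim" by blast
qed

text \<open>
  The \<open>y\<close> with \<open>x \<in> \<psi> y \<cdot> C_n n\<close> form a decreasing sequence of nonempty closed sets, and a point
  of their intersection satisfies \<open>x \<in> \<psi> y \<cdot> C_lim\<close>.
\<close>

lemma Inter_image_mult_C_n:
  assumes "\<And>n. x \<in> (\<psi> ` carrier G) <#> C_n n"
  shows "x \<in> (\<psi> ` carrier G) <#> C_lim"
proof -
  have x: "x \<in> carrier G"
    using assms[of 0] subgroup.subset[OF subgroup_image_mult[OF cotrajectory_n_normal[OF normal]]]
    by blast
  define S where "S n = {y \<in> topspace T. inv (\<psi> y) \<otimes> x \<in> C_n n}" for n
  have "(\<Inter>n. S n) \<noteq> {}"
  proof (rule compact_space_imp_nest[OF compact])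
    have "continuous_map T T (\<lambda>y. inv (\<psi> y) \<otimes> x)"
      using continuous_map_compose[OF cont continuous_inv] x
      by (intro continuous_map_mult continuous_map_const_carrier) (simp_all add: comp_def)
    then show "closedin T (S n)" for n
      unfolding S_def using closedin_C_n by (rule closedin_continuous_map_preimage)
    show "S n \<noteq> {}" for n
    proof -
      obtain y c where yc: "y \<in> carrier G" "c \<in> C_n n" "x = \<psi> y \<otimes> c"
        using assms[of n] by (auto simp: set_mult_def)
      have "c \<in> carrier G" using yc(2) by (simp add: mem_cotrajectory_n_Suc)
      then have "inv (\<psi> y) \<otimes> x = c"
        using yc endo_closed by (simp add: m_assoc[symmetric])
      then show ?thesis using yc by (auto simp: S_def topspace_eq)
    qed
    show "decseq S"
      using decseq_cotrajectory_n[of U] unfolding decseq_def S_def by blast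
  qed
  then obtain y where y: "\<And>n. y \<in> S n" by blast
  then have "inv (\<psi> y) \<otimes> x \<in> C_lim" "y \<in> carrier G"
    unfolding cotrajectory_eq by (auto simp: S_def topspace_eq)
  moreover from this have "x = \<psi> y \<otimes> (inv (\<psi> y) \<otimes> x)"
    using x endo_closed by (simp add: m_assoc[symmetric])
  ultimately show ?thesis unfolding set_mult_def by blast
qed

text \<open>
  Each \<open>Im \<psi> \<cdot> C_n n\<close> is a union of cosets of \<open>P = Im \<psi> \<cdot> C_lim\<close>. There are finitely many of these,
  and by the previous lemma only \<open>P\<close> itself lies in all of the unions.
\<close>

lemma image_mult_C_n_stabilize:
  assumes fin: "finite (r_coset G ((\<psi> ` carrier G) <#> C_lim) ` carrier G)"
  shows "eventually (\<lambda>n. (\<psi> ` carrier G) <#> C_n n = (\<psi> ` carrier G) <#> C_lim) sequentially"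
proof -
  define P where "P = (\<psi> ` carrier G) <#> C_lim"
  define A where "A n = (\<psi> ` carrier G) <#> C_n n" for n
  have P: "subgroup P G"
    unfolding P_def by (rule subgroup_image_mult[OF cotrajectory_normal[OF normal]])
  have A: "subgroup (A n) G" for n
    unfolding A_def by (rule subgroup_image_mult[OF cotrajectory_n_normal[OF normal]])
  have PA: "P \<subseteq> A n" for n
    unfolding P_def A_def set_mult_def cotrajectory_eq by blast
  have "eventually (\<lambda>n. r_coset G P ` A n = r_coset G P ` P) sequentially"
  proof (rule decseq_image_stabilizes)
    show "decseq A"
      using decseq_cotrajectory_n[of U] unfolding decseq_def A_def set_mult_def by blast
    show "P \<subseteq> A n" for n by (rule PA)
    show "finite (r_coset G P ` A 0)"
      using finite_subset[OF image_mono[OF subgroup.subset[OF A]]] fin unfolding P_def .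
    fix D assume D: "\<And>n. D \<in> r_coset G P ` A n"
    then obtain x where x: "x \<in> carrier G" "D = P #> x"
      using subgroup.mem_carrier[OF A] by blast
    have "x \<in> A n" for n
    proof -
      obtain y where y: "y \<in> A n" "P #> x = P #> y" using D x(2) by blast
      have "x \<in> P #> y" using rcos_self[OF x(1) P] y(2) by simp
      then show ?thesis
        using y(1) PA[of n] subgroup.m_closed[OF A] by (auto simp: r_coset_def)
    qed
    then have "x \<in> P" unfolding A_def P_def by (rule Inter_image_mult_C_n)
    then show "D \<in> r_coset G P ` P" using x(2) by blast
  qed
  then have "eventually (\<lambda>n. A n = P) sequentially"
  proof eventually_elim
    case (elim n)
    have "x \<in> P" if "x \<in> A n" for x
    proof -
      obtain p where p: "p \<in> P" "P #> x = P #> p" using elim \<open>x \<in> A n\<close> by blast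
      have "P #> p = P"
        using p(1) rcoset_eq_self_iff[OF P] subgroup.mem_carrier[OF P] by blast
      then show ?thesis
        using p(2) that rcoset_eq_self_iff[OF P] subgroup.mem_carrier[OF A] by metis
    qed
    then show ?case using PA by blast
  qed
  then show ?thesis unfolding A_def P_def .
qed

end

section \<open>The growth rate\<close>

text \<open>
  Eventually \<open>ln (c n)\<close> is an arithmetic progression with difference \<open>ln \<alpha> - ln \<beta>\<close>. Positivity is
  required from index 1 on, which is where the cotrajectories are subgroups of finite index.
\<close>

lemma ln_growth_rate:
  fixes c :: "nat \<Rightarrow> nat" and \<alpha> \<beta> :: nat
  assumes "\<And>n. c (Suc n) > 0" "\<alpha> > 0" "\<beta> > 0"
    and "eventually (\<lambda>n. c (Suc n) * \<beta> = c n * \<alpha>) sequentially"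
  shows "(\<lambda>n. ln (real (c n)) / real n) \<longlonglongrightarrow> ln (real \<alpha>) - ln (real \<beta>)"
proof -
  define d where "d = ln (real \<alpha>) - ln (real \<beta>)"
  obtain N where N: "\<And>n. n \<ge> N \<Longrightarrow> c (Suc n) * \<beta> = c n * \<alpha>"
    using assms(4) unfolding eventually_sequentially by blast
  \<comment> \<open>Starting at a successor makes \<open>c n\<close> positive for all \<open>n \<ge> M\<close>.\<close>
  define M where "M = Suc N"
  have step: "ln (real (c (Suc n))) = ln (real (c n)) + d" if n: "n \<ge> M" for n
  proof -
    have pos: "c n > 0" "c (Suc n) > 0"
      using assms(1) n unfolding M_def by (metis Suc_le_D) (rule assms(1))
    have "real (c (Suc n)) * real \<beta> = real (c n) * real \<alpha>"
      using N[of n] n unfolding M_def by (metis Suc_leD of_nat_mult)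
    then have "ln (real (c (Suc n)) * real \<beta>) = ln (real (c n) * real \<alpha>)" by simp
    then show ?thesis
      using pos assms by (simp add: ln_mult d_def)
  qed
  have "ln (real (c (M + k))) = ln (real (c M)) + real k * d" for k
    by (induction k) (simp_all add: step algebra_simps)
  then have lin: "ln (real (c n)) = ln (real (c M)) + real (n - M) * d" if "n \<ge> M" for n
    using that by (metis le_add_diff_inverse)
  have "(\<lambda>n. (ln (real (c M)) - real M * d) / real n + d) \<longlonglongrightarrow> 0 + d"
    by (intro tendsto_add lim_const_over_n tendsto_const)
  moreover have "eventually (\<lambda>n. (ln (real (c M)) - real M * d) / real n + d
      = ln (real (c n)) / real n) sequentially"
    using eventually_ge_at_top[of "max M 1"]
  proof eventually_elim
    case (elim n)
    then have "real (n - M) = real n - real M" "real n > 0" by auto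
    then show ?case using lin[of n] elim by (simp add: field_simps)
  qed
  ultimately show ?thesis
    unfolding d_def[symmetric] using Lim_transform_eventually by fastforce
qed

theorem theorem3p3:
  fixes K :: "('a, 'b) monoid_scheme" and T :: "'a topology"
    and \<psi> :: "'a \<Rightarrow> 'a" and U :: "'a set"
  assumes "topological_group K T"
    and "compact_space T"
    and "totally_disconnected_space T"
    and "\<psi> \<in> hom K K"
    and "continuous_map T T \<psi>"
    and "U \<lhd> K"
    and "openin T U"
    and "finite (rcosets\<^bsub>K\<^esub> ((\<psi> ` carrier K) <#>\<^bsub>K\<^esub> cotrajectory K \<psi> U))"
  shows "H_top K \<psi> U =
      ln (real (group_index (K\<lparr>carrier := preimage_on K \<psi> (cotrajectory K \<psi> U)\<rparr>)
                            (cotrajectory K \<psi> U)))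
    - ln (real (group_index K ((\<psi> ` carrier K) <#>\<^bsub>K\<^esub> cotrajectory K \<psi> U)))"
proof -
  interpret topological_group K T by fact
  interpret compact_group_endomorphism K T \<psi> U
    by (intro compact_group_endomorphism.intro compact_group_endomorphism_axioms.intro
        group_endomorphism.intro group_endomorphism_axioms.intro
        topological_group_axioms group_axioms) (fact assms)+
  define P where "P = (\<psi> ` carrier K) <#>\<^bsub>K\<^esub> C_lim"
  define \<alpha> where "\<alpha> = card (r_coset K U ` preimage_on K \<psi> C_lim)"
  define \<beta> where "\<beta> = card (r_coset K P ` carrier K)"
  define c where "c n = card (r_coset K (cotrajectory_n K \<psi> U n) ` carrier K)" for n
  have finP: "finite (r_coset K P ` carrier K)"
    using assms(8) unfolding P_def RCOSETS_eq_image .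
  have prenormal: "preimage_on K \<psi> C_lim \<lhd> K"
    using preimage_normal[OF cotrajectory_normal[OF normal]] .
  have "\<one>\<^bsub>K\<^esub> \<in> preimage_on K \<psi> C_lim"
    using prenormal normal_imp_subgroup subgroup.one_closed by blast
  moreover have "finite (r_coset K U ` preimage_on K \<psi> C_lim)"
    by (rule finite_subset[OF _ finite_rcosets_U]) (auto simp: preimage_on_def)
  ultimately have "\<alpha> > 0" unfolding \<alpha>_def by (auto simp: card_gt_0_iff)
  have ne: "carrier K \<noteq> {}" using one_closed by blast
  then have "\<beta> > 0" unfolding \<beta>_def using finP by (simp add: card_gt_0_iff)
  have cpos: "c (Suc n) > 0" for n
    unfolding c_def using finite_rcosets_C_n ne by (simp add: card_gt_0_iff)
  have rec: "c (Suc (Suc n)) * card (r_coset K ((\<psi> ` carrier K) <#>\<^bsub>K\<^esub> C_n n) ` carrier K)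
      = c (Suc n) * card (r_coset K U ` preimage_on K \<psi> (C_n n))" for n
    using index_recursion(2)[OF normal cotrajectory_n_normal[OF normal] finite_rcosets_U
        finite_rcosets_C_n]
    by (simp add: c_def cotrajectory_n_Suc_Suc[OF U_subset])
  have "eventually (\<lambda>n. c (Suc (Suc n)) * \<beta> = c (Suc n) * \<alpha>) sequentially"
    using rcosets_preimage_stabilize image_mult_C_n_stabilize[OF finP[unfolded P_def]]
  proof eventually_elim
    case (elim n)
    then show ?case using rec[of n] by (simp add: \<alpha>_def \<beta>_def P_def)
  qed
  then have "eventually (\<lambda>n. c (Suc n) * \<beta> = c n * \<alpha>) sequentially"
    by (subst (asm) eventually_sequentially_Suc)
  from ln_growth_rate[OF cpos \<open>\<alpha> > 0\<close> \<open>\<beta> > 0\<close> this]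
  have "H_top K \<psi> U = ln (real \<alpha>) - ln (real \<beta>)"
    unfolding H_top_def group_index_eq c_def by (rule limI)
  moreover have "\<alpha> = group_index (K\<lparr>carrier := preimage_on K \<psi> C_lim\<rparr>) C_lim"
    using rcosets_Int(1)[OF normal_imp_subgroup[OF prenormal] subgroup_U]
      cotrajectory_invariance[OF U_subset]
    by (simp add: \<alpha>_def group_index_carrier_update)
  moreover have "\<beta> = group_index K P"
    by (simp add: \<beta>_def group_index_eq)
  ultimately show ?thesis unfolding P_def by simp
qed

end
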